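(* Let $\widehat M\in\mathbb{R}^{s\times s}$ have eigendecomposition $\widehat M=T\Lambda T^{-1}$ with $\Lambda=\mathrm{diag}(\lambda_1,\dots,\lambda_s)$, and assume $\lambda_i\pi_j\ne1$ for all $i=1,\dots,s$, $j=1,\dots,N+1$. Let $P\in\mathbb{C}^{s\times(N+1)}$ be such that $P_{i,j}=1/(1-\lambda_i\pi_j)$, and let $$U=I_s+\Lambda\,\mathrm{diag}\big(P(Fe_1\circ F^{-T}e_{N+1})\big)\in\mathbb{C}^{s\times s}.$$ Let $V\in\mathbb{R}^{s\times(N+1)}$. Then the solution $Z$ to the Stein equation $Z-\widehat MZ\Sigma^T=V$ can be written as $$Z=T(Y-W)F^{-T},$$ where $$Y=P\circ(T^{-1}VF^T),\qquad W=P\circ\big(U^{-1}(\Lambda YF^{-1}e_{N+1})e_1^TF^T\big).$$ Similarly, the solution $Z$ to the equation $Z-\widehat M^TZ\Sigma=V$ is such that $$Z=T^{-T}(G-H)F,$$ where $$G=P\circ(T^TVF^{-1}),\qquad H=P\circ\big(U^{-1}(\Lambda GF^Te_1)e_{N+1}^TF^{-1}\big).$$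
   Context: $N,s\ge1$ are integers; $\Sigma\in\mathbb{R}^{(N+1)\times(N+1)}$ has ones on the first subdiagonal and zeros elsewhere, so that $\Sigma=C-e_1e_{N+1}^T$, where $C$ is the cyclic shift (circulant) matrix with $Ce_j=e_{j+1}$ for $j\le N$ and $Ce_{N+1}=e_1$. $F\in\mathbb{C}^{(N+1)\times(N+1)}$ is the (unnormalized, symmetric) discrete Fourier matrix $F_{jk}=\omega^{(j-1)(k-1)}$ with $\omega=e^{-2\pi \mathrm{i}/(N+1)}$. It diagonalizes $C$: $C=F^{-1}\Pi F$ with $\Pi=\mathrm{diag}(\pi_1,\dots,\pi_{N+1})$ and $(\pi_1,\dots,\pi_{N+1})^T=FCe_1$. Here $e_i$ is the $i$-th canonical basis vector of $\mathbb{R}^{N+1}$, $\circ$ is the Hadamard (entrywise) product, $\mathrm{diag}(x)$ of a vector $x$ is the diagonal matrix with diagonal $x$, and superscript $T$ denotes the (non-conjugate) transpose, $A^{-T}=(A^{-1})^T$. The matrices $T,\Lambda$ may be complex. *)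

theory Defs
  imports
    Complex_Main
    "Jordan_Normal_Form.Matrix"
    "Jordan_Normal_Form.Gauss_Jordan_Elimination"
begin

(* Rows, columns and vector entries are indexed from 0 throughout, so the canonical
   basis vectors e_1 and e_n of dimension n are unit_vec n 0 and unit_vec n (n - 1). *)

definition sigma_mat :: "nat \<Rightarrow> real mat" where
  "sigma_mat n = mat n n (\<lambda>(i, j). if i = j + 1 then 1 else 0)"

definition cyclic_shift_mat :: "nat \<Rightarrow> real mat" where
  "cyclic_shift_mat n = mat n n (\<lambda>(i, j). if i = (j + 1) mod n then 1 else 0)"

definition dft_mat :: "nat \<Rightarrow> complex mat" where
  "dft_mat n = mat n n (\<lambda>(j, k). exp (- (2 * complex_of_real pi * \<i>) / of_nat n) ^ (j * k))"

abbreviation complex_mat :: "real mat \<Rightarrow> complex mat" where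
  "complex_mat A \<equiv> map_mat complex_of_real A"

definition diag_of_vec :: "'a :: zero vec \<Rightarrow> 'a mat" where
  "diag_of_vec x = mat_diag (dim_vec x) (\<lambda>i. x $ i)"

(* The inverse of an invertible square matrix; unspecified for any other matrix. *)
definition mat_inv :: "'a :: field mat \<Rightarrow> 'a mat" where
  "mat_inv A = the (mat_inverse A)"

(* The Hadamard product of vectors is the library's component_mult. *)
definition hadamard_mat :: "'a :: times mat \<Rightarrow> 'a mat \<Rightarrow> 'a mat" (infixl "\<circ>\<^sub>H" 70) where
  "A \<circ>\<^sub>H B = mat (dim_row A) (dim_col A) (\<lambda>(i, j). A $$ (i, j) * B $$ (i, j))"

(* The rank-one matrix x y^T (no conjugation). *)
definition outer_mat :: "'a :: semiring_0 vec \<Rightarrow> 'a vec \<Rightarrow> 'a mat" where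
  "outer_mat x y = mat_of_cols (dim_vec x) [x] * mat_of_row y"

(* The vector (pi_1, ..., pi_n)^T = F C e_1. *)
definition shift_eigvals :: "nat \<Rightarrow> complex vec" where
  "shift_eigvals n = dft_mat n *\<^sub>v (complex_mat (cyclic_shift_mat n) *\<^sub>v unit_vec n 0)"

lemma outer_mat_dim [simp]:
  "dim_row (outer_mat x y) = dim_vec x" "dim_col (outer_mat x y) = dim_vec y"
  unfolding outer_mat_def mat_of_row_def by auto

lemma outer_mat_index:
  "i < dim_vec x \<Longrightarrow> j < dim_vec y \<Longrightarrow> outer_mat x y $$ (i, j) = x $ i * y $ j"
  unfolding outer_mat_def mat_of_row_def
  by (simp add: scalar_prod_def mat_of_cols_def)

lemma sigma_mat_eq_cyclic_shift:
  "sigma_mat (N + 1) =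
     cyclic_shift_mat (N + 1) - outer_mat (unit_vec (N + 1) 0) (unit_vec (N + 1) N)"
proof (rule eq_matI, goal_cases)
  case (1 i j)
  then have ij: "i < N + 1" "j < N + 1" by auto
  show ?case
    by (cases "j = N")
      (use ij in \<open>auto simp: sigma_mat_def cyclic_shift_mat_def outer_mat_index\<close>)
qed (auto simp: sigma_mat_def)

end

theory Submission
  imports Defs
begin

text \<open>
  In the basis that diagonalises \<open>M\<close> on one side and the circulant matrix \<open>C\<close> on the other, the
  Stein equation with \<open>C\<close> in place of \<open>C - e\<^sub>1 e\<^sub>n\<^sup>T\<close> (\<open>n = N + 1\<close>) is solved entrywise by multiplication with \<open>P\<close>.
  The rank-one correction involves the unknown only through one vector, for which the solution
  formula gives a diagonal linear system with matrix \<open>U\<close>. Its diagonal entries are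
  \<open>1 / (1 - \<lambda>\<^sub>i\<^sup>n)\<close>, by the geometric series for the resolvent of \<open>C\<close>, so \<open>U\<close> is invertible.
  Existence of a solution follows from the nilpotency of \<open>\<Sigma>\<close>, uniqueness from the explicit formula.
\<close>

section \<open>Inverses of square and of diagonal matrices\<close>

text \<open>\<open>mat_inv\<close> is read off from an option, so the value \<open>None\<close> has
  to be excluded first: it would say that \<open>A\<close> is not a unit of the matrix ring. What
  remains is uniqueness of inverses.\<close>

lemma mat_inv_eqI:
  fixes A :: "'a :: field mat"
  assumes "A \<in> carrier_mat n n" "B \<in> carrier_mat n n" "A * B = 1\<^sub>m n" "B * A = 1\<^sub>m n"
  shows "mat_inv A = B"
proof (cases "mat_inverse A")
  case None
  from mat_inverse(1)[OF assms(1) this, of undefined] assms show ?thesis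
    by (auto simp: Units_def ring_mat_def)
next
  case (Some C)
  from mat_inverse(2)[OF assms(1) this]
  have C: "A * C = 1\<^sub>m n" "C \<in> carrier_mat n n" by auto
  have "B = B * (A * C)" using C assms by simp
  also have "\<dots> = (B * A) * C" using C assms by (intro assoc_mult_mat[symmetric]) auto
  also have "\<dots> = C" unfolding assms(4) using C by simp
  finally show ?thesis using Some by (simp add: mat_inv_def)
qed

lemma mat_inv_of_invertible:
  fixes A :: "'a :: field mat"
  assumes A: "A \<in> carrier_mat n n" and "invertible_mat A"
  shows "mat_inv A \<in> carrier_mat n n" "A * mat_inv A = 1\<^sub>m n" "mat_inv A * A = 1\<^sub>m n"
proof -
  obtain B where B: "A * B = 1\<^sub>m (dim_row A)" "B * A = 1\<^sub>m (dim_row B)"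
    using assms(2) by (auto simp: invertible_mat_def inverts_mat_def)
  \<comment> \<open>\<open>invertible_mat\<close> does not fix the shape of its witness; comparing
    the dimensions of both sides of the two identities recovers it.\<close>
  have "dim_col B = n" using arg_cong[OF B(1), of dim_col] A by simp
  moreover have "dim_row B = n" using arg_cong[OF B(2), of dim_col] A by simp
  ultimately have Bc: "B \<in> carrier_mat n n" by auto
  have "mat_inv A = B" using mat_inv_eqI[OF A Bc] A B Bc by auto
  then show "mat_inv A \<in> carrier_mat n n" "A * mat_inv A = 1\<^sub>m n" "mat_inv A * A = 1\<^sub>m n"
    using A B Bc by auto
qed

lemma invertible_mat_diag:
  fixes f :: "nat \<Rightarrow> 'a :: field"
  assumes "\<And>i. i < n \<Longrightarrow> f i \<noteq> 0"
  shows "invertible_mat (mat_diag n f)"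
proof -
  let ?g = "\<lambda>i. inverse (f i)"
  have "mat_diag n (\<lambda>i. f i * ?g i) = 1\<^sub>m n" "mat_diag n (\<lambda>i. ?g i * f i) = 1\<^sub>m n"
    using assms by (auto simp: mat_diag_def intro!: eq_matI)
  then have "inverts_mat (mat_diag n f) (mat_diag n ?g)" "inverts_mat (mat_diag n ?g) (mat_diag n f)"
    by (simp_all add: inverts_mat_def carrier_matD(1)[OF mat_diag_dim])
  then show ?thesis unfolding invertible_mat_def by (auto simp: mat_diag_def)
qed

section \<open>Stein equations with diagonal coefficients and a rank-one term\<close>

lemma diag_mult_vec_index:
  fixes A :: "'a :: semiring_0 mat"
  assumes "A \<in> carrier_mat s n" "lam \<in> carrier_vec s" "b \<in> carrier_vec n" "i < s"
  shows "(diag_of_vec lam * A *\<^sub>v b) $ i = lam $ i * (A *\<^sub>v b) $ i"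
proof -
  have "diag_of_vec lam * A = mat s n (\<lambda>(i, j). lam $ i * A $$ (i, j))"
    using mat_diag_mult_left[OF assms(1)] assms by (simp add: diag_of_vec_def)
  then show ?thesis using assms
    by (auto simp: scalar_prod_def sum_distrib_left mult.assoc)
qed

text \<open>Applied to \<open>U\<close>, this reduces its invertibility and the linear system solved
  with it to scalar statements.\<close>

lemma one_plus_diag_mult_diag:
  fixes lam q :: "'a :: semiring_1 vec"
  assumes "lam \<in> carrier_vec s" "q \<in> carrier_vec s"
  shows "1\<^sub>m s + diag_of_vec lam * diag_of_vec q = mat_diag s (\<lambda>i. 1 + lam $ i * q $ i)"
proof -
  have "diag_of_vec lam * diag_of_vec q = mat_diag s (\<lambda>i. lam $ i * q $ i)"
    using assms by (simp add: diag_of_vec_def)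
  then show ?thesis by (auto simp: mat_diag_def intro!: eq_matI)
qed

text \<open>In the coordinates diagonalising both coefficients, a Stein equation is entrywise, up to a
  rank-one term that depends on the unknown only through \<open>X b\<close>; multiplying by \<open>b\<close> closes
  the system for \<open>X b\<close>.\<close>

lemma diagonal_stein_rank_one_solution:
  fixes X Q P :: "'a :: field mat" and lam d a b :: "'a vec"
  assumes X: "X \<in> carrier_mat s n" and Q: "Q \<in> carrier_mat s n"
    and lam: "lam \<in> carrier_vec s" and d: "d \<in> carrier_vec n"
    and a: "a \<in> carrier_vec n" and b: "b \<in> carrier_vec n"
    and eq: "X - diag_of_vec lam * X * diag_of_vec d
               + outer_mat (diag_of_vec lam * X *\<^sub>v b) a = Q"
    and ne: "\<And>i j. i < s \<Longrightarrow> j < n \<Longrightarrow> lam $ i * d $ j \<noteq> 1"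
    and P: "P \<in> carrier_mat s n"
    and Pij: "\<And>i j. i < s \<Longrightarrow> j < n \<Longrightarrow> P $$ (i, j) = 1 / (1 - lam $ i * d $ j)"
    and U: "U = 1\<^sub>m s + diag_of_vec lam * diag_of_vec (P *\<^sub>v component_mult a b)"
    and inv: "invertible_mat U"
  shows "X = P \<circ>\<^sub>H Q
    - P \<circ>\<^sub>H outer_mat (mat_inv U *\<^sub>v (diag_of_vec lam * (P \<circ>\<^sub>H Q) *\<^sub>v b)) a"
proof -
  let ?L = "diag_of_vec lam" and ?G = "P \<circ>\<^sub>H Q"
  let ?w = "?L * X *\<^sub>v b"
  define q where "q = P *\<^sub>v component_mult a b"
  have q: "q \<in> carrier_vec s" unfolding q_def using P a b
    by (intro mult_mat_vec_carrier[of _ s n]) (auto simp: component_mult_def)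
  have qi: "q $ i = (\<Sum>j<n. P $$ (i, j) * (a $ j * b $ j))" if "i < s" for i
    using that P a b unfolding q_def
    by (auto simp: scalar_prod_def component_mult_def atLeast0LessThan intro!: sum.cong)
  have L: "?L \<in> carrier_mat s s" using lam by (auto simp: diag_of_vec_def)
  have G: "?G \<in> carrier_mat s n" using P by (auto simp: hadamard_mat_def)
  have w: "?w \<in> carrier_vec s" using L X by (intro mult_mat_vec_carrier[of _ s n] b) auto
  have LX: "?L * X = mat s n (\<lambda>(i, j). lam $ i * X $$ (i, j))"
    using mat_diag_mult_left[OF X] lam by (simp add: diag_of_vec_def)
  have LXD: "?L * X * diag_of_vec d = mat s n (\<lambda>(i, j). lam $ i * X $$ (i, j) * d $ j)"
    using d mat_diag_mult_right[of "?L * X" s n "\<lambda>j. d $ j"]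
    by (auto simp: diag_of_vec_def LX[unfolded diag_of_vec_def] intro!: eq_matI)
  \<comment> \<open>Each entry can be divided by \<open>1 - lam $ i * d $ j\<close>; the unknown
    survives on the right only through the vector \<open>?w\<close>.\<close>
  have Xij: "X $$ (i, j) = ?G $$ (i, j) - P $$ (i, j) * (?w $ i * a $ j)" if "i < s" "j < n" for i j
  proof -
    have "(X - ?L * X * diag_of_vec d + outer_mat ?w a) $$ (i, j) = Q $$ (i, j)" using eq by simp
    moreover have "outer_mat ?w a $$ (i, j) = ?w $ i * a $ j"
      using that w a L by (intro outer_mat_index) auto
    ultimately have "X $$ (i, j) * (1 - lam $ i * d $ j) + ?w $ i * a $ j = Q $$ (i, j)"
      using that X w a L unfolding LXD by (simp add: algebra_simps)
    then have "X $$ (i, j) * (1 - lam $ i * d $ j) = Q $$ (i, j) - ?w $ i * a $ j"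
      by (simp add: eq_diff_eq)
    then have "X $$ (i, j) = P $$ (i, j) * (Q $$ (i, j) - ?w $ i * a $ j)"
      using ne[OF that] by (simp add: Pij[OF that] eq_divide_eq)
    then show ?thesis using that P by (simp add: hadamard_mat_def right_diff_distrib)
  qed
  \<comment> \<open>Pairing row \<open>i\<close> with \<open>b\<close> collects the coefficients of
    \<open>?w $ i\<close> into \<open>q $ i\<close>. A further factor \<open>lam $ i\<close> turns
    \<open>X b\<close> into \<open>?w\<close> and closes the system.\<close>
  have "(X *\<^sub>v b) $ i = (?G *\<^sub>v b) $ i - q $ i * ?w $ i" if i: "i < s" for i
  proof -
    have "(X *\<^sub>v b) $ i = (\<Sum>j<n. X $$ (i, j) * b $ j)"
      using i X b by (auto simp: scalar_prod_def atLeast0LessThan)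
    also have "\<dots> = (\<Sum>j<n. ?G $$ (i, j) * b $ j - P $$ (i, j) * (a $ j * b $ j) * ?w $ i)"
      using i by (intro sum.cong refl) (simp add: Xij algebra_simps)
    also have "\<dots> = (?G *\<^sub>v b) $ i - q $ i * ?w $ i"
      using i G b by (auto simp: sum_subtractf sum_distrib_right qi scalar_prod_def atLeast0LessThan)
    finally show ?thesis .
  qed
  then have "lam $ i * (?G *\<^sub>v b) $ i = lam $ i * ((X *\<^sub>v b) $ i + q $ i * ?w $ i)" if "i < s" for i
    using that by simp
  then have wi: "(1 + lam $ i * q $ i) * ?w $ i = (?L * ?G *\<^sub>v b) $ i" if "i < s" for i
    using that by (simp add: diag_mult_vec_index[OF X lam b] diag_mult_vec_index[OF G lam b] algebra_simps)
  have Ud: "U = mat_diag s (\<lambda>i. 1 + lam $ i * q $ i)"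
    using one_plus_diag_mult_diag[OF lam q] U by (simp add: q_def)
  have Uc: "U \<in> carrier_mat s s" by (simp add: Ud)
  \<comment> \<open>The scalar equations \<open>wi\<close> are the rows of this system, which
    determines \<open>?w\<close> because \<open>U\<close> is invertible.\<close>
  have "U *\<^sub>v ?w = ?L * ?G *\<^sub>v b"
  proof (rule eq_vecI)
    fix i assume "i < dim_vec (?L * ?G *\<^sub>v b)"
    then have i: "i < s" using L by simp
    have "(U *\<^sub>v ?w) $ i = (\<Sum>j<s. (if i = j then 1 + lam $ j * q $ j else 0) * ?w $ j)"
      using i w L by (auto simp: Ud mat_diag_def scalar_prod_def atLeast0LessThan intro!: sum.cong)
    also have "\<dots> = (1 + lam $ i * q $ i) * ?w $ i"
      using i by (subst sum.remove[of _ i]) auto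
    finally show "(U *\<^sub>v ?w) $ i = (?L * ?G *\<^sub>v b) $ i" using wi[OF i] by simp
  qed (use L Uc in auto)
  then have "mat_inv U *\<^sub>v (?L * ?G *\<^sub>v b) = mat_inv U *\<^sub>v (U *\<^sub>v ?w)" by simp
  also have "\<dots> = (mat_inv U * U) *\<^sub>v ?w"
    using mat_inv_of_invertible[OF Uc inv] Uc w by (intro assoc_mult_mat_vec[symmetric]) auto
  also have "\<dots> = ?w" using mat_inv_of_invertible[OF Uc inv] w by simp
  finally have "mat_inv U *\<^sub>v (?L * ?G *\<^sub>v b) = ?w" .
  then show ?thesis using X P Xij w a L G
    by (intro eq_matI) (auto simp: outer_mat_index, auto simp: hadamard_mat_def outer_mat_index)
qed

section \<open>Change of basis to the diagonal case\<close>

lemma outer_mat_carrier: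
  "x \<in> carrier_vec m \<Longrightarrow> y \<in> carrier_vec n \<Longrightarrow> outer_mat x y \<in> carrier_mat m n"
  by auto

lemma mult_outer_mat:
  fixes A :: "'a :: comm_semiring_0 mat"
  assumes "A \<in> carrier_mat m k" "u \<in> carrier_vec k"
  shows "A * outer_mat u a = outer_mat (A *\<^sub>v u) a"
  using assms
  by (intro eq_matI) (auto simp: outer_mat_index scalar_prod_def sum_distrib_right mult.assoc)

lemma outer_mat_mult:
  fixes A :: "'a :: comm_semiring_0 mat"
  assumes "a \<in> carrier_vec k" "A \<in> carrier_mat k n"
  shows "outer_mat u a * A = outer_mat u (A\<^sup>T *\<^sub>v a)"
  using assms
  by (intro eq_matI) (auto simp: outer_mat_index scalar_prod_def sum_distrib_left ac_simps)

text \<open>The substitution \<open>X = R' Z K\<close> makes \<open>A\<close> diagonal exactly and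
  \<open>B\<close> diagonal up to the rank-one defect in \<open>BK\<close>. The diagonal case then
  applies with \<open>b = K' u\<close>, and \<open>Z = R X K'\<close> undoes the substitution. Both
  equations of the theorem are instances.\<close>

lemma stein_eq_solution:
  fixes A B Z R R' K K' :: "'a :: field mat"
  assumes Z: "Z \<in> carrier_mat s n" and V: "V \<in> carrier_mat s n"
    and R: "R \<in> carrier_mat s s" "R' \<in> carrier_mat s s" "R * R' = 1\<^sub>m s" "R' * R = 1\<^sub>m s"
    and K: "K \<in> carrier_mat n n" "K' \<in> carrier_mat n n" "K * K' = 1\<^sub>m n"
    and B: "B \<in> carrier_mat n n"
    and lam: "lam \<in> carrier_vec s" and d: "d \<in> carrier_vec n"
    and a: "a \<in> carrier_vec n" and u: "u \<in> carrier_vec n"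
    and A: "A = R * diag_of_vec lam * R'"
    and BK: "B * K = K * diag_of_vec d - outer_mat u a"
    and eq: "Z - A * Z * B = V"
    and ne: "\<And>i j. i < s \<Longrightarrow> j < n \<Longrightarrow> lam $ i * d $ j \<noteq> 1"
    and P: "P \<in> carrier_mat s n"
    and Pij: "\<And>i j. i < s \<Longrightarrow> j < n \<Longrightarrow> P $$ (i, j) = 1 / (1 - lam $ i * d $ j)"
    and U: "U = 1\<^sub>m s + diag_of_vec lam * diag_of_vec (P *\<^sub>v component_mult a (K' *\<^sub>v u))"
    and inv: "invertible_mat U"
    and G: "G = P \<circ>\<^sub>H (R' * V * K)"
  shows "Z = R * (G - P \<circ>\<^sub>H outer_mat (mat_inv U *\<^sub>v (diag_of_vec lam * G * K' *\<^sub>v u)) a) * K'"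
proof -
  let ?L = "diag_of_vec lam" and ?D = "diag_of_vec d"
  define X where "X = R' * Z * K"
  have X: "X \<in> carrier_mat s n" using R Z K by (simp add: X_def)
  have L: "?L \<in> carrier_mat s s" and D: "?D \<in> carrier_mat n n"
    using lam d by (auto simp: diag_of_vec_def)
  have O: "outer_mat u a \<in> carrier_mat n n" using u a by auto
  define S where "S = R' * Z"
  have S: "S \<in> carrier_mat s n" using R Z by (simp add: S_def)
  have XS: "X = S * K" using X_def S_def by simp
  have XK': "X * K' = S"
    unfolding XS using assoc_mult_mat[OF S K(1,2)] K(3) S by simp
  have LR': "?L * R' \<in> carrier_mat s s" and LS: "?L * S \<in> carrier_mat s n"
    and SB: "S * B \<in> carrier_mat s n" and LX: "?L * X \<in> carrier_mat s n"
    and LSB: "?L * S * B \<in> carrier_mat s n"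
    using L R S B X by auto
  have "A * Z = R * (?L * S)"
    unfolding A S_def using assoc_mult_mat[OF R(1) L R(2)] assoc_mult_mat[OF R(1) LR' Z]
      assoc_mult_mat[OF L R(2) Z] by presburger
  then have "A * Z * B = R * (?L * S * B)"
    using assoc_mult_mat[OF R(1) LS B] by presburger
  then have "R' * (A * Z * B) = ?L * S * B"
    using assoc_mult_mat[OF R(2) R(1) LSB] R(4) left_mult_one_mat[OF LSB] by metis
  \<comment> \<open>Reassociating brings \<open>B\<close> next to \<open>K\<close>, where
    \<open>BK\<close> replaces the product by a diagonal and a rank-one part.\<close>
  then have "R' * (A * Z * B) * K = ?L * (S * (B * K))"
    using assoc_mult_mat[OF L S B] assoc_mult_mat[OF L SB K(1)] assoc_mult_mat[OF S B K(1)]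
    by presburger
  also have "S * (B * K) = S * (K * ?D) - S * outer_mat u a"
    unfolding BK using S K D O by (intro mult_minus_distrib_mat[of _ s n _ n]) auto
  also have "S * (K * ?D) = X * ?D"
    unfolding XS using assoc_mult_mat[OF S K(1) D] by presburger
  also have "?L * (X * ?D - S * outer_mat u a) = ?L * (X * ?D) - ?L * (S * outer_mat u a)"
    by (intro mult_minus_distrib_mat[OF L mult_carrier_mat[OF X D] mult_carrier_mat[OF S O]])
  also have "?L * (X * ?D) = ?L * X * ?D"
    using assoc_mult_mat[OF L X D] by presburger
  \<comment> \<open>Writing \<open>S\<close> as \<open>X * K'\<close> expresses the rank-one part
    through the new unknown, which enters only as \<open>X\<close> applied to
    \<open>K' u\<close>.\<close>
  also have "?L * (S * outer_mat u a) = ?L * X * K' * outer_mat u a"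
    using assoc_mult_mat[OF L X K(2)] assoc_mult_mat[OF L S O] XK' by presburger
  also have "\<dots> = outer_mat (?L * X * K' *\<^sub>v u) a"
    using mult_outer_mat[OF mult_carrier_mat[OF LX K(2)] u] .
  also have "?L * X * K' *\<^sub>v u = ?L * X *\<^sub>v (K' *\<^sub>v u)"
    using assoc_mult_mat_vec[OF LX K(2) u] .
  finally have AZB: "R' * (A * Z * B) * K = ?L * X * ?D - outer_mat (?L * X *\<^sub>v (K' *\<^sub>v u)) a" .
  have AZBc: "A * Z * B \<in> carrier_mat s n" unfolding A using R L Z B by (intro mult_carrier_mat) auto
  have "R' * V * K = (R' * Z - R' * (A * Z * B)) * K"
    unfolding eq[symmetric] using R Z AZBc by (subst mult_minus_distrib_mat[of _ s s _ n]) auto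
  also have "\<dots> = X - R' * (A * Z * B) * K"
    unfolding X_def using R Z AZBc K by (intro minus_mult_distrib_mat[of _ s n _ _ n]) auto
  finally have "R' * V * K = X - (?L * X * ?D - outer_mat (?L * X *\<^sub>v (K' *\<^sub>v u)) a)"
    unfolding AZB .
  also have "\<dots> = X - ?L * X * ?D + outer_mat (?L * X *\<^sub>v (K' *\<^sub>v u)) a"
  proof -
    have "X - (S - E) = X - S + E" if "S \<in> carrier_mat s n" "E \<in> carrier_mat s n" for S E :: "'a mat"
      using X that by (auto intro!: eq_matI)
    from this[OF mult_carrier_mat[OF LX D] outer_mat_carrier[OF _ a]] show ?thesis
      using mult_mat_vec_carrier[OF LX mult_mat_vec_carrier[OF K(2) u]] by simp
  qed
  finally have main: "X - ?L * X * ?D + outer_mat (?L * X *\<^sub>v (K' *\<^sub>v u)) a = R' * V * K" by simp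
  have Gc: "G \<in> carrier_mat s n" using P by (simp add: G hadamard_mat_def)
  have "X = G - P \<circ>\<^sub>H outer_mat (mat_inv U *\<^sub>v (?L * G *\<^sub>v (K' *\<^sub>v u))) a"
    unfolding G using X R V K u
    by (intro diagonal_stein_rank_one_solution[OF X _ lam d a _ main ne P Pij U inv]) auto
  moreover have "?L * G *\<^sub>v (K' *\<^sub>v u) = ?L * G * K' *\<^sub>v u"
    using assoc_mult_mat_vec[OF mult_carrier_mat[OF L Gc] K(2) u] by simp
  moreover have "R * X * K' = Z"
  proof -
    have "R * X * K' = R * S" using assoc_mult_mat[OF R(1) X K(2)] XK' by simp
    also have "\<dots> = (R * R') * Z" unfolding S_def using assoc_mult_mat[OF R(1,2) Z] by simp
    finally show ?thesis using R(3) Z by simp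
  qed
  ultimately show ?thesis by simp
qed

section \<open>Existence of solutions from nilpotency\<close>

text \<open>By induction on \<open>m\<close>, the partial sums of the Neumann series solve the equation up to the error
  \<open>A\<^sup>m V B\<^sup>m\<close> (with \<open>E = A\<^sup>m V\<close>), which vanishes for \<open>m = k\<close>.\<close>

lemma stein_nilpotent_exists:
  fixes A B V :: "'a :: comm_ring_1 mat"
  assumes A: "A \<in> carrier_mat s s" and B: "B \<in> carrier_mat n n" and V: "V \<in> carrier_mat s n"
    and nil: "B ^\<^sub>m k = 0\<^sub>m n n"
  shows "\<exists>Z. Z \<in> carrier_mat s n \<and> Z - A * Z * B = V"
proof -
  have rearrange: "(Z + T) - (p + q) = ((Z - p) + T) - q" "(V - T) + T = V"
    if "Z \<in> carrier_mat s n" "T \<in> carrier_mat s n" "p \<in> carrier_mat s n" "q \<in> carrier_mat s n"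
    for Z T p q :: "'a mat"
    using that V by (auto intro!: eq_matI)
  have "\<exists>Z E. Z \<in> carrier_mat s n \<and> E \<in> carrier_mat s n \<and> Z - A * Z * B = V - E * B ^\<^sub>m m" for m
  proof (induction m)
    case 0
    have "0\<^sub>m s n - A * 0\<^sub>m s n * B = V - V * B ^\<^sub>m 0" using A B V by simp
    then show ?case using V by (intro exI[of _ "0\<^sub>m s n"] exI[of _ V]) auto
  next
    case (Suc m)
    then obtain Z E where Z: "Z \<in> carrier_mat s n" and E: "E \<in> carrier_mat s n"
      and eq: "Z - A * Z * B = V - E * B ^\<^sub>m m" by auto
    let ?T = "E * B ^\<^sub>m m"
    have T: "?T \<in> carrier_mat s n" using E B by simp
    \<comment> \<open>Adding the current error \<open>?T\<close> to the approximation cancels it and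
      leaves the new error \<open>A * ?T * B\<close>, so \<open>E\<close> is replaced by
      \<open>A * E\<close> and the power of \<open>B\<close> grows by one.\<close>
    have "A * (Z + ?T) * B = A * Z * B + A * ?T * B"
      using A B Z T by (simp add: mult_add_distrib_mat[of _ s s _ n] add_mult_distrib_mat[of _ s n _ _ n])
    moreover have "A * Z * B \<in> carrier_mat s n" "A * ?T * B \<in> carrier_mat s n"
      using A B Z T by simp_all
    ultimately have "(Z + ?T) - A * (Z + ?T) * B = V - A * ?T * B"
      using rearrange[OF Z T] eq by simp
    also have "A * ?T * B = (A * E) * B ^\<^sub>m m * B"
      using A B E by (subst assoc_mult_mat[of A s s E n _ n]) auto
    also have "\<dots> = (A * E) * B ^\<^sub>m Suc m"
      using A B E by (subst assoc_mult_mat[of _ s n _ n B n]) auto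
    finally have "(Z + ?T) - A * (Z + ?T) * B = V - (A * E) * B ^\<^sub>m Suc m" .
    then show ?case
      using add_carrier_mat[OF T, of Z] mult_carrier_mat[OF A E] by blast
  qed
  from this[of k] obtain Z E where "Z \<in> carrier_mat s n" "E \<in> carrier_mat s n"
    "Z - A * Z * B = V - E * 0\<^sub>m n n" unfolding nil by auto
  then show ?thesis using V by (intro exI[of _ Z]) auto
qed

lemma sigma_mat_carrier [simp]: "sigma_mat n \<in> carrier_mat n n"
  by (simp add: sigma_mat_def)

lemma sigma_mat_mult_index:
  assumes "A \<in> carrier_mat m n" "i < m" "j < n"
  shows "(A * sigma_mat n) $$ (i, j) = (if j + 1 < n then A $$ (i, j + 1) else 0)"
    and "(A * (sigma_mat n)\<^sup>T) $$ (i, j) = (if j = 0 then 0 else A $$ (i, j - 1))"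
proof -
  have "(A * sigma_mat n) $$ (i, j) = (\<Sum>k<n. A $$ (i, k) * (if k = j + 1 then 1 else 0))"
    using assms by (simp add: sigma_mat_def scalar_prod_def atLeast0LessThan)
  also have "\<dots> = (\<Sum>k<n. if k = j + 1 then A $$ (i, j + 1) else 0)"
    by (intro sum.cong) auto
  finally show "(A * sigma_mat n) $$ (i, j) = (if j + 1 < n then A $$ (i, j + 1) else 0)"
    by simp
  have "(A * (sigma_mat n)\<^sup>T) $$ (i, j) = (\<Sum>k<n. A $$ (i, k) * (if j = k + 1 then 1 else 0))"
    using assms by (simp add: sigma_mat_def scalar_prod_def atLeast0LessThan)
  \<comment> \<open>For \<open>j = 0\<close> the truncated difference \<open>j - 1\<close> is
    \<open>0\<close>, so the sum does select \<open>k = 0\<close>; the inner conditional makes that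
    term vanish.\<close>
  also have "\<dots> = (\<Sum>k<n. if k = j - 1 then if j = 0 then 0 else A $$ (i, j - 1) else 0)"
    by (intro sum.cong) auto
  finally show "(A * (sigma_mat n)\<^sup>T) $$ (i, j) = (if j = 0 then 0 else A $$ (i, j - 1))"
    using assms by simp
qed

text \<open>Each further factor moves the line of ones one subdiagonal down; for
  \<open>k = n\<close> it has left the matrix, which gives nilpotency.\<close>

lemma sigma_mat_pow: "sigma_mat n ^\<^sub>m k = mat n n (\<lambda>(i, j). if i = j + k then 1 else 0)"
proof (induction k)
  case 0
  show ?case by (intro eq_matI) (auto simp: sigma_mat_def)
next
  case (Suc k)
  show ?case
  proof (rule eq_matI)
    fix i j
    assume "i < dim_row (mat n n (\<lambda>(i, j). if i = j + Suc k then 1 else 0 :: real))"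
      and "j < dim_col (mat n n (\<lambda>(i, j). if i = j + Suc k then 1 else 0 :: real))"
    then have ij: "i < n" "j < n" by auto
    show "(sigma_mat n ^\<^sub>m Suc k) $$ (i, j)
        = mat n n (\<lambda>(i, j). if i = j + Suc k then 1 else 0) $$ (i, j)"
      unfolding pow_mat.simps sigma_mat_mult_index(1)[OF pow_carrier_mat[OF sigma_mat_carrier] ij]
      using ij by (auto simp: Suc)
  qed (auto simp: sigma_mat_def)
qed

lemma sigma_mat_transpose_pow:
  "(sigma_mat n)\<^sup>T ^\<^sub>m k = mat n n (\<lambda>(i, j). if j = i + k then 1 else 0)"
proof (induction k)
  case 0
  show ?case by (intro eq_matI) (auto simp: sigma_mat_def)
next
  case (Suc k)
  have T: "(sigma_mat n)\<^sup>T \<in> carrier_mat n n" by simp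
  show ?case
  proof (rule eq_matI)
    fix i j
    assume "i < dim_row (mat n n (\<lambda>(i, j). if j = i + Suc k then 1 else 0 :: real))"
      and "j < dim_col (mat n n (\<lambda>(i, j). if j = i + Suc k then 1 else 0 :: real))"
    then have ij: "i < n" "j < n" by auto
    show "((sigma_mat n)\<^sup>T ^\<^sub>m Suc k) $$ (i, j)
        = mat n n (\<lambda>(i, j). if j = i + Suc k then 1 else 0) $$ (i, j)"
      unfolding pow_mat.simps sigma_mat_mult_index(2)[OF pow_carrier_mat[OF T] ij]
      using ij by (auto simp: Suc)
  qed (auto simp: sigma_mat_def)
qed

lemma sigma_mat_nilpotent:
  "sigma_mat n ^\<^sub>m n = 0\<^sub>m n n" "(sigma_mat n)\<^sup>T ^\<^sub>m n = 0\<^sub>m n n"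
  by (auto simp: sigma_mat_pow sigma_mat_transpose_pow)

section \<open>The discrete Fourier matrix and its inverse\<close>

lemma mult_mat_unit_vec_index:
  fixes A :: "'a :: semiring_1 mat"
  assumes "A \<in> carrier_mat m n" "i < m" "k < n"
  shows "(A *\<^sub>v unit_vec n k) $ i = A $$ (i, k)"
  using assms by (simp add: scalar_prod_right_unit)

definition dft_root :: "nat \<Rightarrow> complex" where
  "dft_root n = exp (- (2 * complex_of_real pi * \<i>) / of_nat n)"

lemma dft_mat_carrier [simp]: "dft_mat n \<in> carrier_mat n n"
  by (simp add: dft_mat_def)

lemma dft_mat_index: "j < n \<Longrightarrow> k < n \<Longrightarrow> dft_mat n $$ (j, k) = dft_root n ^ (j * k)"
  by (simp add: dft_mat_def dft_root_def)

lemma dft_mat_transpose [simp]: "(dft_mat n)\<^sup>T = dft_mat n"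
  by (intro eq_matI) (auto simp: dft_mat_def mult.commute)

lemma dft_root_nonzero [simp]: "dft_root n \<noteq> 0"
  by (simp add: dft_root_def)

lemma dft_root_power_order: "n > 0 \<Longrightarrow> dft_root n ^ n = 1"
  unfolding dft_root_def exp_of_nat_mult[symmetric] by (simp add: exp_minus)

text \<open>The root is primitive: its powers are the inverses of the standard roots of unity, which
  the exponents below \<open>n\<close> enumerate injectively.\<close>

lemma dft_root_power_ne_1:
  assumes "0 < k" "k < n"
  shows "dft_root n ^ k \<noteq> 1"
proof
  assume "dft_root n ^ k = 1"
  moreover have "dft_root n ^ k = inverse (cis (2 * pi * real k / real n))"
    by (simp add: dft_root_def cis_conv_exp algebra_simps flip: exp_of_nat_mult exp_minus)
  ultimately have "inverse (inverse (cis (2 * pi * real k / real n))) = 1"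
    by (metis inverse_1)
  then have "cis (2 * pi * real k / real n) = cis (2 * pi * real 0 / real n)"
    by (simp only: inverse_inverse_eq) simp
  moreover have inj: "inj_on (\<lambda>k. cis (2 * pi * real k / real n)) {..<n}"
    using bij_betw_roots_unity[of n] assms by (auto simp: bij_betw_def)
  ultimately have "k = 0" using assms by (intro inj_onD[OF inj, of k 0]) auto
  with assms show False by simp
qed

text \<open>For \<open>j \<noteq> l\<close> the sum is geometric, and its ratio \<open>x\<close> is
  an \<open>n\<close>-th root of unity other than 1.\<close>

lemma dft_root_orthogonality:
  assumes "j < n" "l < n"
  shows "(\<Sum>k<n. dft_root n ^ (j * k) * inverse (dft_root n ^ (k * l))) = (if j = l then of_nat n else 0)"
proof (cases "j = l")
  case True
  then show ?thesis by (simp add: mult.commute)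
next
  case False
  define x where "x = dft_root n ^ j / dft_root n ^ l"
  have "x \<noteq> 1"
  proof
    assume "x = 1"
    then have eq: "dft_root n ^ j = dft_root n ^ l" by (simp add: x_def)
    \<comment> \<open>The exponent difference is a natural number, so the two powers are separated
      for ordered exponents and the result is used in both orders.\<close>
    have ne: "dft_root n ^ a \<noteq> dft_root n ^ b" if "a < b" "b < n" for a b
      using that dft_root_power_ne_1[of "b - a" n] by (auto simp: power_diff less_imp_diff_less)
    show False using ne[of j l] ne[of l j] eq False assms by (cases "j < l") auto
  qed
  moreover have "x ^ n = 1"
  proof -
    have "(dft_root n ^ a) ^ n = 1" for a
      using assms dft_root_power_order[of n]
      by (metis gr_zeroI not_less0 power_mult mult.commute power_one)
    then show ?thesis by (simp add: x_def power_divide)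
  qed
  moreover have "dft_root n ^ (j * k) * inverse (dft_root n ^ (k * l)) = x ^ k" for k
    by (simp add: x_def power_divide divide_inverse mult.commute[of k] power_mult
        power_mult_distrib power_inverse)
  ultimately show ?thesis using False by (simp add: geometric_sum)
qed

lemma dft_mat_inv:
  assumes "n > 0"
  shows "mat_inv (dft_mat n) \<in> carrier_mat n n"
    and "dft_mat n * mat_inv (dft_mat n) = 1\<^sub>m n" "mat_inv (dft_mat n) * dft_mat n = 1\<^sub>m n"
    and "(mat_inv (dft_mat n))\<^sup>T = mat_inv (dft_mat n)"
proof -
  \<comment> \<open>Orthogonality dictates this candidate: the entrywise inverses, which are the
    complex conjugates, scaled by \<open>1 / n\<close>.\<close>
  define E where "E = mat n n (\<lambda>(j, k). inverse (dft_root n ^ (j * k)) / of_nat n)"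
  have E: "E \<in> carrier_mat n n" by (simp add: E_def)
  have Et: "E\<^sup>T = E" by (intro eq_matI) (auto simp: E_def mult.commute)
  have FE: "dft_mat n * E = 1\<^sub>m n"
  proof (rule eq_matI)
    fix j l assume "j < dim_row (1\<^sub>m n :: complex mat)" "l < dim_col (1\<^sub>m n :: complex mat)"
    then have jl: "j < n" "l < n" by auto
    have "(dft_mat n * E) $$ (j, l)
      = (\<Sum>k<n. dft_root n ^ (j * k) * inverse (dft_root n ^ (k * l))) / of_nat n"
      using jl by (simp add: scalar_prod_def dft_mat_def dft_root_def E_def atLeast0LessThan
          sum_divide_distrib)
    then show "(dft_mat n * E) $$ (j, l) = 1\<^sub>m n $$ (j, l)"
      using jl by (simp add: dft_root_orthogonality)
  qed (auto simp: dft_mat_def E_def)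
  \<comment> \<open>Both matrices are symmetric, so transposing one identity yields the
    other.\<close>
  moreover have EF: "E * dft_mat n = 1\<^sub>m n"
    using arg_cong[OF FE, of transpose_mat] transpose_mult[OF dft_mat_carrier E] Et by simp
  ultimately have "mat_inv (dft_mat n) = E" using E by (intro mat_inv_eqI[of _ n]) auto
  then show "mat_inv (dft_mat n) \<in> carrier_mat n n"
    and "dft_mat n * mat_inv (dft_mat n) = 1\<^sub>m n" "mat_inv (dft_mat n) * dft_mat n = 1\<^sub>m n"
    and "(mat_inv (dft_mat n))\<^sup>T = mat_inv (dft_mat n)"
    using E FE EF Et by auto
qed

section \<open>The shift in Fourier coordinates and its resolvent\<close>

lemma shift_eigvals_carrier [simp]: "shift_eigvals n \<in> carrier_vec n"
  unfolding shift_eigvals_def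
  by (intro mult_mat_vec_carrier[of _ n n]) (auto simp: cyclic_shift_mat_def)

lemma shift_eigvals_index:
  assumes "j < n"
  shows "shift_eigvals n $ j = dft_root n ^ j"
proof -
  \<comment> \<open>The index \<open>1 mod n\<close> also covers \<open>n = 1\<close>, where the
    shift is the identity; there \<open>j = 0\<close>, so the exponent \<open>j * (1 mod n)\<close>
    still equals \<open>j\<close>.\<close>
  have "complex_mat (cyclic_shift_mat n) *\<^sub>v unit_vec n 0 = unit_vec n (1 mod n)"
  proof (rule eq_vecI)
    fix i assume "i < dim_vec (unit_vec n (1 mod n) :: complex vec)"
    then show "(complex_mat (cyclic_shift_mat n) *\<^sub>v unit_vec n 0) $ i = unit_vec n (1 mod n) $ i"
      using assms by (subst mult_mat_unit_vec_index[of _ n]) (auto simp: cyclic_shift_mat_def unit_vec_def)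
  qed (simp add: cyclic_shift_mat_def)
  then have "shift_eigvals n $ j = dft_root n ^ (j * (1 mod n))"
    using assms by (simp add: shift_eigvals_def mult_mat_unit_vec_index[of _ n n] dft_mat_index)
  also have "j * (1 mod n) = j" using assms by (cases "n = 1") auto
  finally show ?thesis .
qed

lemma dft_mat_mult_unit_0:
  assumes "j < n"
  shows "(dft_mat n *\<^sub>v unit_vec n 0) $ j = 1"
  using assms by (simp add: mult_mat_unit_vec_index[of _ n n] dft_mat_index)

text \<open>This is \<open>F C = Pi F\<close> with the rank-one difference between \<open>C\<close>
  and Sigma carried along. Entrywise, Sigma shifts the columns of \<open>F\<close> to the left,
  which multiplies row \<open>j\<close> by the \<open>j\<close>-th power of the root. In the last
  column the shift leaves 0 whereas that product is 1, and the outer product subtracts this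
  1.\<close>

lemma dft_mat_mult_sigma:
  "dft_mat (Suc N) * complex_mat (sigma_mat (Suc N))
     = diag_of_vec (shift_eigvals (Suc N)) * dft_mat (Suc N)
       - outer_mat (dft_mat (Suc N) *\<^sub>v unit_vec (Suc N) 0) (unit_vec (Suc N) N)"
    (is "?A = ?B - outer_mat ?u ?e")
proof (rule eq_matI)
  let ?n = "Suc N" let ?w = "dft_root ?n"
  have u: "?u \<in> carrier_vec ?n" by (intro mult_mat_vec_carrier[OF dft_mat_carrier]) auto
  fix j i assume "j < dim_row (?B - outer_mat ?u ?e)" "i < dim_col (?B - outer_mat ?u ?e)"
  then have ji: "j < ?n" "i < ?n" using u by (auto simp: dft_mat_def)
  have "?A $$ (j, i) = (\<Sum>k<?n. ?w ^ (j * k) * (if k = i + 1 then 1 else 0))"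
    using ji by (simp add: sigma_mat_def scalar_prod_def dft_mat_def dft_root_def atLeast0LessThan
        if_distrib[of complex_of_real] del: sum.lessThan_Suc cong: if_cong)
  also have "\<dots> = (\<Sum>k<?n. if k = i + 1 then ?w ^ (j * (i + 1)) else 0)"
    by (intro sum.cong) auto
  also have "\<dots> = (if i < N then ?w ^ (j * (i + 1)) else 0)"
    by (simp del: sum.lessThan_Suc)
  also have "\<dots> = ?w ^ j * ?w ^ (j * i) - (if i = N then 1 else 0)"
  proof -
    have "?w ^ j * ?w ^ (j * N) = 1"
      using dft_root_power_order[of ?n]
      by (metis mult.commute mult_Suc_right power_add power_mult power_one zero_less_Suc)
    moreover have "i = N" if "\<not> i < N" using that ji by simp
    ultimately show ?thesis by (auto simp: power_add)
  qed
  also have "?w ^ j * ?w ^ (j * i) = ?B $$ (j, i)"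
    using ji mat_diag_mult_left[of "dft_mat ?n" ?n ?n "\<lambda>i. shift_eigvals ?n $ i"]
    by (simp add: diag_of_vec_def carrier_vecD[OF shift_eigvals_carrier] shift_eigvals_index dft_mat_index)
  also have "(if i = N then 1 else 0) = outer_mat ?u ?e $$ (j, i)"
    using ji carrier_vecD[OF u] dft_mat_mult_unit_0[OF ji(1)]
    by (simp add: outer_mat_index del: index_mult_mat_vec)
  finally show "?A $$ (j, i) = (?B - outer_mat ?u ?e) $$ (j, i)"
    using ji carrier_vecD[OF u] by (subst index_minus_mat) (simp_all del: dim_mult_mat_vec)
qed (auto simp: diag_of_vec_def dft_mat_def sigma_mat_def carrier_vecD[OF shift_eigvals_carrier])

text \<open>The sum is the bottom left entry of \<open>(I - x C)\<^sup>-\<^sup>1\<close> for the cyclic shift \<open>C\<close>; the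
  resolvent is a finite geometric series in \<open>C\<close> because the shift has order \<open>N + 1\<close>.\<close>

lemma shift_resolvent_corner:
  assumes "\<And>j. j < Suc N \<Longrightarrow> x * shift_eigvals (Suc N) $ j \<noteq> 1"
  shows "(1 - x ^ Suc N) * (\<Sum>j<Suc N. mat_inv (dft_mat (Suc N)) $$ (N, j)
            / (1 - x * shift_eigvals (Suc N) $ j)) = x ^ N"
proof -
  let ?n = "Suc N" let ?w = "dft_root ?n" let ?E = "mat_inv (dft_mat ?n)"
  \<comment> \<open>All the numbers \<open>x * ?w ^ j\<close> have the same \<open>n\<close>-th
    power \<open>x ^ ?n\<close>, so the single factor \<open>1 - x ^ ?n\<close> clears every
    denominator.\<close>
  have geo: "(1 - x ^ ?n) * (c / (1 - x * shift_eigvals ?n $ j)) = (\<Sum>k<?n. x ^ k * (c * ?w ^ (j * k)))"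
    if j: "j < ?n" for j c
  proof -
    have "(x * ?w ^ j) ^ ?n = x ^ ?n"
      using dft_root_power_order[of ?n]
      by (metis mult.commute mult.right_neutral power_mult power_mult_distrib power_one zero_less_Suc)
    then have "1 - x ^ ?n = (1 - x * ?w ^ j) * (\<Sum>k<?n. (x * ?w ^ j) ^ k)"
      using one_diff_power_eq[of "x * ?w ^ j" ?n] by presburger
    then have "(1 - x ^ ?n) * (c / (1 - x * ?w ^ j)) = c * (\<Sum>k<?n. (x * ?w ^ j) ^ k)"
      using assms[OF j] j by (simp add: shift_eigvals_index del: sum.lessThan_Suc power_Suc)
    then show ?thesis
      using j by (simp add: shift_eigvals_index sum_distrib_left power_mult_distrib ac_simps
          del: sum.lessThan_Suc power_Suc flip: power_mult)
  qed
  have E: "?E \<in> carrier_mat ?n ?n" by (simp add: dft_mat_inv)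
  have "(1 - x ^ ?n) * (\<Sum>j<?n. ?E $$ (N, j) / (1 - x * shift_eigvals ?n $ j))
      = (\<Sum>j<?n. \<Sum>k<?n. x ^ k * (?E $$ (N, j) * ?w ^ (j * k)))"
    unfolding sum_distrib_left by (intro sum.cong refl) (use geo in auto)
  \<comment> \<open>After the exchange the inner sum is entry \<open>(N, k)\<close> of the inverse
    times the Fourier matrix, so only \<open>k = N\<close> contributes.\<close>
  also have "\<dots> = (\<Sum>k<?n. x ^ k * (\<Sum>j<?n. ?E $$ (N, j) * ?w ^ (j * k)))"
    by (subst sum.swap) (simp only: sum_distrib_left)
  also have "\<dots> = (\<Sum>k<?n. x ^ k * (?E * dft_mat ?n) $$ (N, k))"
    using E by (intro sum.cong refl)
      (simp add: scalar_prod_def dft_mat_def dft_root_def atLeast0LessThan del: sum.lessThan_Suc)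
  also have "\<dots> = (\<Sum>k<?n. if k = N then x ^ N else 0)"
    by (intro sum.cong) (auto simp: dft_mat_inv)
  finally show ?thesis by (simp del: sum.lessThan_Suc power_Suc)
qed

section \<open>The two Stein equations with the subdiagonal shift\<close>

theorem proposition3:
  fixes N s :: nat
    and M V :: "real mat"
    and T L P U F Y W G H :: "complex mat"
    and lam \<pi> e1 eN1 :: "complex vec"
  assumes "N \<ge> 1" and "s \<ge> 1"
    and "F = dft_mat (N + 1)"
    and "\<pi> = shift_eigvals (N + 1)"
    and "e1 = unit_vec (N + 1) 0"
    and "eN1 = unit_vec (N + 1) N"
    and "M \<in> carrier_mat s s"
    and "T \<in> carrier_mat s s" and "invertible_mat T"
    and "lam \<in> carrier_vec s"
    and "L = diag_of_vec lam"
    and "complex_mat M = T * L * mat_inv T"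
    and "\<And>i j. i < s \<Longrightarrow> j < N + 1 \<Longrightarrow> lam $ i * \<pi> $ j \<noteq> 1"
    and "P \<in> carrier_mat s (N + 1)"
    and "\<And>i j. i < s \<Longrightarrow> j < N + 1 \<Longrightarrow> P $$ (i, j) = 1 / (1 - lam $ i * \<pi> $ j)"
    and "U = 1\<^sub>m s + L * diag_of_vec
               (P *\<^sub>v component_mult (F *\<^sub>v e1) ((mat_inv F)\<^sup>T *\<^sub>v eN1))"
    and "V \<in> carrier_mat s (N + 1)"
    and "Y = P \<circ>\<^sub>H (mat_inv T * complex_mat V * F\<^sup>T)"
    and "W = P \<circ>\<^sub>H (outer_mat (mat_inv U *\<^sub>v (L * Y * mat_inv F *\<^sub>v eN1)) e1 * F\<^sup>T)"
    and "G = P \<circ>\<^sub>H (T\<^sup>T * complex_mat V * mat_inv F)"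
    and "H = P \<circ>\<^sub>H (outer_mat (mat_inv U *\<^sub>v (L * G * F\<^sup>T *\<^sub>v e1)) eN1 * mat_inv F)"
  shows "invertible_mat U
    \<and> (\<exists>!Z. Z \<in> carrier_mat s (N + 1) \<and> Z - M * Z * (sigma_mat (N + 1))\<^sup>T = V)
    \<and> (\<forall>Z. Z \<in> carrier_mat s (N + 1) \<and> Z - M * Z * (sigma_mat (N + 1))\<^sup>T = V \<longrightarrow>
          complex_mat Z = T * (Y - W) * (mat_inv F)\<^sup>T)
    \<and> (\<exists>!Z. Z \<in> carrier_mat s (N + 1) \<and> Z - M\<^sup>T * Z * sigma_mat (N + 1) = V)
    \<and> (\<forall>Z. Z \<in> carrier_mat s (N + 1) \<and> Z - M\<^sup>T * Z * sigma_mat (N + 1) = V \<longrightarrow>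
          complex_mat Z = (mat_inv T)\<^sup>T * (G - H) * F)"
proof -
  let ?n = "N + 1" and ?E = "mat_inv F" and ?S = "complex_mat (sigma_mat (N + 1))"
  have F: "F \<in> carrier_mat ?n ?n" "F\<^sup>T = F"
    and E: "?E \<in> carrier_mat ?n ?n" "F * ?E = 1\<^sub>m ?n" "?E * F = 1\<^sub>m ?n" "?E\<^sup>T = ?E"
    using dft_mat_inv[of ?n] by (simp_all add: assms(3))
  have e1: "e1 \<in> carrier_vec ?n" and eN1: "eN1 \<in> carrier_vec ?n" by (simp_all add: assms(5,6))
  have pi: "\<pi> \<in> carrier_vec ?n" by (simp add: assms(4) del: One_nat_def add_Suc_right)
  note T = assms(8) mat_inv_of_invertible[OF assms(8,9)]
  have L: "L \<in> carrier_mat s s" using assms(10,11) by (auto simp: diag_of_vec_def)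
  have LT: "L\<^sup>T = L" unfolding assms(11) diag_of_vec_def mat_diag_def by (intro eq_matI) auto
  have DT: "(diag_of_vec \<pi>)\<^sup>T = diag_of_vec \<pi>"
    unfolding diag_of_vec_def mat_diag_def by (intro eq_matI) auto
  have D: "diag_of_vec \<pi> \<in> carrier_mat ?n ?n" using pi by (auto simp: diag_of_vec_def)
  have S: "?S \<in> carrier_mat ?n ?n" by simp
  define a b where "a = F *\<^sub>v e1" and "b = ?E\<^sup>T *\<^sub>v eN1"
  have a: "a \<in> carrier_vec ?n" and b: "b \<in> carrier_vec ?n"
    using F E e1 eN1 by (auto simp: a_def b_def)

  have FS: "F * ?S = diag_of_vec \<pi> * F - outer_mat a eN1"
    using dft_mat_mult_sigma[of N] by (simp add: assms(3-6) a_def)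
  \<comment> \<open>The relation for the first equation: the transpose of \<open>FS\<close>, where
    \<open>F\<close> and the diagonal factor are symmetric.\<close>
  have SF: "?S\<^sup>T * F = F * diag_of_vec \<pi> - outer_mat eN1 a"
  proof -
    have "?S\<^sup>T * F = (F * ?S)\<^sup>T" using transpose_mult[OF F(1) S] F(2) by simp
    also have "\<dots> = (diag_of_vec \<pi> * F)\<^sup>T - (outer_mat a eN1)\<^sup>T"
      unfolding FS by (intro transpose_minus[OF mult_carrier_mat[OF D F(1)] outer_mat_carrier[OF a eN1]])
    also have "(outer_mat a eN1)\<^sup>T = outer_mat eN1 a"
      using a eN1 by (intro eq_matI) (auto simp: outer_mat_index mult.commute)
    finally show ?thesis using transpose_mult[OF D F(1)] DT F(2) by simp
  qed
  \<comment> \<open>The relation for the second equation: \<open>FS\<close> multiplied by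
    \<open>?E\<close> from both sides, which turns the column \<open>a\<close> into
    \<open>e1\<close> and the row of \<open>eN1\<close> into that of \<open>b\<close>.\<close>
  have SE: "?S * ?E = ?E * diag_of_vec \<pi> - outer_mat e1 b"
  proof -
    note [simp del] = assoc_mult_mat
    have DF: "diag_of_vec \<pi> * F \<in> carrier_mat ?n ?n" and O: "outer_mat a eN1 \<in> carrier_mat ?n ?n"
      using mult_carrier_mat[OF D F(1)] outer_mat_carrier[OF a eN1] by auto
    have "?S * ?E = ?E * (F * ?S) * ?E"
      using assoc_mult_mat[OF E(1) F(1) S] E(3) left_mult_one_mat[OF S] by simp
    also have "?E * (F * ?S) = ?E * (diag_of_vec \<pi> * F) - ?E * outer_mat a eN1"
      unfolding FS using mult_minus_distrib_mat[OF E(1) DF O] .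
    also have "?E * outer_mat a eN1 = outer_mat (?E *\<^sub>v a) eN1"
      using mult_outer_mat[OF E(1) a] .
    also have "?E *\<^sub>v a = e1"
      unfolding a_def using assoc_mult_mat_vec[OF E(1) F(1) e1] E(3) e1 by simp
    also have "(?E * (diag_of_vec \<pi> * F) - outer_mat e1 eN1) * ?E
        = ?E * (diag_of_vec \<pi> * F) * ?E - outer_mat e1 eN1 * ?E"
      using minus_mult_distrib_mat[OF mult_carrier_mat[OF E(1) DF] outer_mat_carrier[OF e1 eN1] E(1)] .
    also have "outer_mat e1 eN1 * ?E = outer_mat e1 b"
      unfolding b_def using outer_mat_mult[OF eN1 E(1)] .
    also have "?E * (diag_of_vec \<pi> * F) * ?E = ?E * diag_of_vec \<pi>"
      using assoc_mult_mat[OF E(1) D F(1)] assoc_mult_mat[OF mult_carrier_mat[OF E(1) D] F(1) E(1)]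
        E(2) right_mult_one_mat[OF mult_carrier_mat[OF E(1) D]] by simp
    finally show ?thesis .
  qed

  have U: "U = 1\<^sub>m s + diag_of_vec lam * diag_of_vec (P *\<^sub>v component_mult a b)"
    using assms(16) by (simp add: assms(11) a_def b_def)
  define q where "q = P *\<^sub>v component_mult a b"
  have q: "q \<in> carrier_vec s"
    unfolding q_def using assms(14) a b
    by (intro mult_mat_vec_carrier[of _ s ?n]) (auto simp: component_mult_def)
  \<comment> \<open>All entries of \<open>a\<close> are 1 and \<open>b\<close> is the last row of
    \<open>?E\<close>, so \<open>q $ i\<close> is the corner sum of
    \<open>shift_resolvent_corner\<close>. The product with \<open>1 - lam $ i ^ Suc N\<close> then
    equals 1, so neither factor vanishes.\<close>
  have "1 + lam $ i * q $ i \<noteq> 0" if i: "i < s" for i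
  proof -
    have "q $ i = (\<Sum>j<?n. P $$ (i, j) * (a $ j * b $ j))"
      using i assms(14) a b unfolding q_def
      by (auto simp: scalar_prod_def component_mult_def atLeast0LessThan simp del: sum.lessThan_Suc
          intro!: sum.cong)
    also have "\<dots> = (\<Sum>j<?n. mat_inv (dft_mat (Suc N)) $$ (N, j)
        / (1 - lam $ i * shift_eigvals (Suc N) $ j))"
    proof (intro sum.cong refl)
      fix j assume "j \<in> {..<?n}"
      then have j: "j < ?n" by simp
      have "a $ j = 1" using dft_mat_mult_unit_0[OF j] by (simp add: a_def assms(3,5))
      moreover have "b $ j = ?E $$ (N, j)"
        unfolding b_def assms(6) using j E(1) by (subst mult_mat_unit_vec_index[of _ ?n]) auto
      ultimately show "P $$ (i, j) * (a $ j * b $ j) = mat_inv (dft_mat (Suc N)) $$ (N, j)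
          / (1 - lam $ i * shift_eigvals (Suc N) $ j)"
        using assms(15)[OF i j] by (simp add: assms(3,4))
    qed
    finally have "(1 - lam $ i ^ Suc N) * q $ i = lam $ i ^ N"
      using shift_resolvent_corner[of N "lam $ i"] assms(13)[OF i] by (simp add: assms(4))
    then have "(1 - lam $ i ^ Suc N) * (lam $ i * q $ i) = lam $ i ^ Suc N"
      by (simp add: mult.left_commute)
    then have "(1 - lam $ i ^ Suc N) * (1 + lam $ i * q $ i) = 1"
      by (simp add: distrib_left del: power_Suc)
    then show ?thesis by auto
  qed
  then have inv: "invertible_mat U"
    unfolding U one_plus_diag_mult_diag[OF assms(10) q, unfolded q_def]
    by (intro invertible_mat_diag) (simp add: q_def)

  \<comment> \<open>Solutions are real while the formulas are complex; injectivity of the embedding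
    turns equal formulas into equal solutions.\<close>
  have inj: "Z = Z'" if "complex_mat Z = complex_mat Z'" for Z Z'
    using that by (rule of_real_hom.mat_hom_inj)
  have cmap: "complex_mat Z - complex_mat A * complex_mat Z * complex_mat B = complex_mat V"
    if "Z \<in> carrier_mat s ?n" "A \<in> carrier_mat s s" "B \<in> carrier_mat ?n ?n" "Z - A * Z * B = V"
    for Z A B
  proof -
    note AZ = mult_carrier_mat[OF that(2,1)]
    have "complex_mat (X - X') = complex_mat X - complex_mat X'"
      if "X \<in> carrier_mat s ?n" "X' \<in> carrier_mat s ?n" for X X'
      using that by (intro eq_matI) auto
    from this[OF that(1) mult_carrier_mat[OF AZ that(3)]]
    have "complex_mat V = complex_mat Z - complex_mat (A * Z * B)"
      unfolding that(4) .
    then show ?thesis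
      by (simp add: of_real_hom.mat_hom_mult[OF AZ that(3)] of_real_hom.mat_hom_mult[OF that(2,1)]
          del: assoc_mult_mat)
  qed
  have cV: "complex_mat V \<in> carrier_mat s ?n" using assms(17) by simp

  \<comment> \<open>The instance \<open>R = T\<close>, \<open>K = F\<close> with
    \<open>u = eN1\<close>.\<close>
  have sol1: "complex_mat Z = T * (Y - W) * ?E\<^sup>T"
    if Z: "Z \<in> carrier_mat s ?n" "Z - M * Z * (sigma_mat ?n)\<^sup>T = V" for Z
  proof -
    have "complex_mat Z = T * (Y - P \<circ>\<^sub>H outer_mat (mat_inv U *\<^sub>v
        (diag_of_vec lam * Y * ?E *\<^sub>v eN1)) a) * ?E"
    proof (rule stein_eq_solution[OF _ cV T(1,2,3,4) F(1) E(1,2) _ assms(10) pi a eN1 _ SF _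
          assms(13) assms(14) assms(15) _ inv])
      show "complex_mat Z - complex_mat M * complex_mat Z * ?S\<^sup>T = complex_mat V"
        using cmap[OF Z(1) assms(7) _ Z(2)] by (simp add: map_mat_transpose)
    qed (use Z(1) S assms(11,12,18) U F(2) E(4) in \<open>simp_all add: b_def\<close>)
    moreover have "outer_mat x e1 * F\<^sup>T = outer_mat x a" for x
      using outer_mat_mult[OF e1 F(1)] F(2) by (simp add: a_def)
    ultimately show ?thesis using E(4) by (simp add: assms(11,19))
  qed

  \<comment> \<open>The instance with \<open>R\<close> the inverse transpose of \<open>T\<close>,
    \<open>K = ?E\<close> and \<open>u = e1\<close>.\<close>
  have sol2: "complex_mat Z = (mat_inv T)\<^sup>T * (G - H) * F"
    if Z: "Z \<in> carrier_mat s ?n" "Z - M\<^sup>T * Z * sigma_mat ?n = V" for Z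
  proof -
    have MT: "complex_mat (M\<^sup>T) = (mat_inv T)\<^sup>T * L * T\<^sup>T"
    proof -
      have "complex_mat (M\<^sup>T) = (T * L * mat_inv T)\<^sup>T"
        using assms(12) by (simp add: map_mat_transpose[symmetric])
      also have "\<dots> = (mat_inv T)\<^sup>T * (T * L)\<^sup>T"
        by (rule transpose_mult[OF mult_carrier_mat[OF T(1) L] T(2)])
      also have "(T * L)\<^sup>T = L * T\<^sup>T" using transpose_mult[OF T(1) L] LT by simp
      also have "(mat_inv T)\<^sup>T * (L * T\<^sup>T) = (mat_inv T)\<^sup>T * L * T\<^sup>T"
        using T L by (intro assoc_mult_mat[symmetric]) auto
      finally show ?thesis .
    qed
    have TT: "(mat_inv T)\<^sup>T \<in> carrier_mat s s" "T\<^sup>T \<in> carrier_mat s s"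
      "(mat_inv T)\<^sup>T * T\<^sup>T = 1\<^sub>m s" "T\<^sup>T * (mat_inv T)\<^sup>T = 1\<^sub>m s"
      using T(1,2) transpose_mult[OF T(1,2), unfolded T(3), symmetric]
        transpose_mult[OF T(2,1), unfolded T(4), symmetric]
      by auto
    \<comment> \<open>The second equation interchanges the roles of \<open>a\<close> and
      \<open>b\<close>; by commutativity of the entrywise product the same \<open>U\<close> serves
      both.\<close>
    have "component_mult a b = component_mult b a"
      using a b by (intro eq_vecI) (auto simp: component_mult_def mult.commute)
    with U have U': "U = 1\<^sub>m s + diag_of_vec lam * diag_of_vec (P *\<^sub>v component_mult b (F *\<^sub>v e1))"
      by (simp add: a_def)
    have "complex_mat Z = (mat_inv T)\<^sup>T * (G - P \<circ>\<^sub>H outer_mat (mat_inv U *\<^sub>v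
        (diag_of_vec lam * G * F *\<^sub>v e1)) b) * F"
    proof (rule stein_eq_solution[OF _ cV TT E(1) F(1) E(3) S assms(10) pi b e1 _ SE _
          assms(13) assms(14) assms(15) U' inv])
      show "complex_mat Z - complex_mat (M\<^sup>T) * complex_mat Z * ?S = complex_mat V"
        using cmap[OF Z(1) _ _ Z(2)] assms(7) by simp
    qed (use Z(1) MT assms(11,20) in simp_all)
    moreover have "outer_mat x eN1 * ?E = outer_mat x b" for x
      unfolding b_def using outer_mat_mult[OF eN1 E(1)] .
    ultimately show ?thesis using F(2) by (simp add: assms(11,21))
  qed

  \<comment> \<open>Existence is obtained over the reals, so the solution is real even where
    \<open>T\<close> and \<open>lam\<close> are not; \<open>sol1\<close> and \<open>inj\<close> give
    uniqueness.\<close>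
  have "\<exists>!Z. Z \<in> carrier_mat s ?n \<and> Z - M * Z * (sigma_mat ?n)\<^sup>T = V"
    using stein_nilpotent_exists[OF assms(7) _ assms(17) sigma_mat_nilpotent(2)] sol1 inj
    by (metis sigma_mat_carrier transpose_carrier_mat)
  moreover have "\<exists>!Z. Z \<in> carrier_mat s ?n \<and> Z - M\<^sup>T * Z * sigma_mat ?n = V"
    using stein_nilpotent_exists[OF _ sigma_mat_carrier assms(17) sigma_mat_nilpotent(1)] sol2 inj assms(7)
    by (metis transpose_carrier_mat)
  ultimately show ?thesis using inv sol1 sol2 by blast
qed

end
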